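(* Let $R$ be a commutative ring with nonzero identity. For every cyclic $R$-module $M$, $cl(AG(M))\geq |Min(M)|$, and if $|Min(M)|\geq 3$, then $gr(AG(M))=3$.
   Context: For a submodule $N\leq M$, $(N:M)=\{r\in R : rM\subseteq N\}$. The product of submodules $N,K\leq M$ is $NK:=(N:M)(K:M)M$. The annihilating-submodule graph $AG(M)$ is the undirected graph whose vertices are the nonzero submodules $N$ of $M$ (possibly $N=M$) for which there exists a nonzero proper submodule $K$ of $M$ with $NK=(0)$; two distinct vertices $N,K$ are adjacent if and only if $NK=(0)$. A graph has, by convention, a nonempty vertex set, so statements about $AG(M)$ presuppose that it has at least one vertex. A prime submodule of $M$ is a submodule $P\neq M$ such that whenever $re\in P$ with $r\in R$, $e\in M$, then $r\in (P:M)$ or $e\in P$. $Min(M)$ is the set of minimal prime submodules of $M$ (prime submodules minimal with respect to inclusion). $cl(G)$ is the clique number of $G$, i.e. the supremum of the sizes of complete subgraphs of $G$; infinite values are written $\infty$, both for $cl$ and for $|Min(M)|$. $gr(G)$ is the girth of $G$, the length of a shortest cycle. *)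

theory Defs
  imports
    "HOL-Algebra.Module"
    "HOL-Algebra.Ideal_Product"
    "HOL-Library.Extended_Nat"
begin

definition ecard :: "'a set \<Rightarrow> enat" where
  "ecard A = (if finite A then enat (card A) else \<infinity>)"

section \<open>Undirected graphs\<close>

text \<open>An undirected graph is a pair of a vertex set and a set of two-element edges.\<close>

type_synonym 'v ugraph = "'v set \<times> 'v set set"

abbreviation uverts :: "'v ugraph \<Rightarrow> 'v set" where "uverts G \<equiv> fst G"

abbreviation uedges :: "'v ugraph \<Rightarrow> 'v set set" where "uedges G \<equiv> snd G"

definition clique :: "'v ugraph \<Rightarrow> 'v set \<Rightarrow> bool" where
  "clique G C \<longleftrightarrow> C \<subseteq> uverts G \<and> pairwise (\<lambda>u v. {u, v} \<in> uedges G) C"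

definition clique_number :: "'v ugraph \<Rightarrow> enat" where
  "clique_number G = (SUP C \<in> {C. clique G C}. ecard C)"

text \<open>A cycle is given by the list of its vertices; the closing edge joins the last vertex to the
  first one.\<close>

definition cycle :: "'v ugraph \<Rightarrow> 'v list \<Rightarrow> bool" where
  "cycle G vs \<longleftrightarrow> length vs \<ge> 3 \<and> distinct vs \<and> set vs \<subseteq> uverts G \<and>
     (\<forall>i < length vs. {vs ! i, vs ! (Suc i mod length vs)} \<in> uedges G)"

text \<open>The girth of an acyclic graph is \<open>\<infinity>\<close>, the infimum of the empty set.\<close>

definition girth :: "'v ugraph \<Rightarrow> enat" where
  "girth G = (INF vs \<in> {vs. cycle G vs}. enat (length vs))"

section \<open>Submodules\<close>

definition colon :: "('a, 'r) ring_scheme \<Rightarrow> ('a, 'b, 'm) module_scheme \<Rightarrow> 'b set \<Rightarrow> 'a set" where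
  "colon R M N = {r \<in> carrier R. \<forall>x \<in> carrier M. r \<odot>\<^bsub>M\<^esub> x \<in> N}"

text \<open>For an ideal \<open>I\<close>, the submodule \<open>IM\<close> consists of the finite sums of products \<open>r x\<close> with
  \<open>r \<in> I\<close> and \<open>x \<in> M\<close>, i.e. it is the submodule generated by these products.\<close>

definition ideal_smult ::
  "('a, 'r) ring_scheme \<Rightarrow> ('a, 'b, 'm) module_scheme \<Rightarrow> 'a set \<Rightarrow> 'b set" where
  "ideal_smult R M I =
     (\<lambda>N. submodule N R M) hull {r \<odot>\<^bsub>M\<^esub> x | r x. r \<in> I \<and> x \<in> carrier M}"

definition submodule_prod ::
  "('a, 'r) ring_scheme \<Rightarrow> ('a, 'b, 'm) module_scheme \<Rightarrow> 'b set \<Rightarrow> 'b set \<Rightarrow> 'b set" where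
  "submodule_prod R M N K = ideal_smult R M (ideal_prod R (colon R M N) (colon R M K))"

definition cyclic_module :: "('a, 'r) ring_scheme \<Rightarrow> ('a, 'b, 'm) module_scheme \<Rightarrow> bool" where
  "cyclic_module R M \<longleftrightarrow>
     (\<exists>m \<in> carrier M. carrier M = {r \<odot>\<^bsub>M\<^esub> m | r. r \<in> carrier R})"

definition prime_submodule ::
  "('a, 'r) ring_scheme \<Rightarrow> ('a, 'b, 'm) module_scheme \<Rightarrow> 'b set \<Rightarrow> bool" where
  "prime_submodule R M P \<longleftrightarrow> submodule P R M \<and> P \<noteq> carrier M \<and>
     (\<forall>r \<in> carrier R. \<forall>e \<in> carrier M. r \<odot>\<^bsub>M\<^esub> e \<in> P \<longrightarrow> r \<in> colon R M P \<or> e \<in> P)"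

definition Min_prime ::
  "('a, 'r) ring_scheme \<Rightarrow> ('a, 'b, 'm) module_scheme \<Rightarrow> 'b set set" where
  "Min_prime R M =
     {P. prime_submodule R M P \<and> (\<forall>Q. prime_submodule R M Q \<and> Q \<subseteq> P \<longrightarrow> Q = P)}"

section \<open>The annihilating-submodule graph\<close>

text \<open>A vertex \<open>N\<close> may be \<open>M\<close> itself, whereas its annihilating partner \<open>K\<close> must be proper
  (and is allowed to equal \<open>N\<close>).\<close>

definition AG_verts ::
  "('a, 'r) ring_scheme \<Rightarrow> ('a, 'b, 'm) module_scheme \<Rightarrow> 'b set set" where
  "AG_verts R M = {N. submodule N R M \<and> N \<noteq> {\<zero>\<^bsub>M\<^esub>} \<and>
     (\<exists>K. submodule K R M \<and> K \<noteq> {\<zero>\<^bsub>M\<^esub>} \<and> K \<noteq> carrier M \<and>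
          submodule_prod R M N K = {\<zero>\<^bsub>M\<^esub>})}"

definition AG :: "('a, 'r) ring_scheme \<Rightarrow> ('a, 'b, 'm) module_scheme \<Rightarrow> 'b set ugraph" where
  "AG R M = (AG_verts R M,
     {{N, K} | N K. N \<in> AG_verts R M \<and> K \<in> AG_verts R M \<and> N \<noteq> K \<and>
        submodule_prod R M N K = {\<zero>\<^bsub>M\<^esub>}})"

end

theory Submission
  imports Defs
begin

text \<open>A generator \<open>g\<close> identifies \<open>M\<close> with \<open>R / ann g\<close>, so that submodules behave like ideals: the
  residual of \<open>N\<close> consists of the \<open>r\<close> with \<open>r g \<in> N\<close>, and a prime submodule \<open>P\<close> amounts to
  the multiplicatively closed set of all \<open>r\<close> with \<open>r g \<notin> P\<close>.

  Let \<open>P\<^sub>1, \<dots>, P\<^sub>n\<close> be distinct minimal primes with \<open>n \<ge> 2\<close>. The point is to find ring elements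
  \<open>a\<^sub>i\<close> with \<open>a\<^sub>i g \<notin> P\<^sub>i\<close> and \<open>a\<^sub>i a\<^sub>j g = 0\<close> for \<open>i \<noteq> j\<close>. The submodules \<open>R a\<^sub>i g\<close> are then
  nonzero and annihilate each other pairwise. They are distinct, because \<open>a\<^sub>i g = r a\<^sub>j g\<close> would give
  \<open>a\<^sub>i\<^sup>2 g = r a\<^sub>i a\<^sub>j g = 0 \<in> P\<^sub>i\<close>, against primality; for the same reason none of them is all
  of \<open>M\<close>. So they are \<open>n\<close> pairwise adjacent vertices.

  Two distinct minimal primes \<open>P\<close> and \<open>Q\<close> are handled by \<open>minimal_primes_separated\<close>: take \<open>b\<close>
  with \<open>b g \<in> P\<close> and \<open>b g \<notin> Q\<close>; minimality of \<open>P\<close> yields \<open>s\<close> with \<open>s g \<notin> P\<close> and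
  \<open>b\<^sup>k s g = 0\<close> for some \<open>k\<close> (\<open>minimal_prime_annihilator\<close>, which rests on Zorn's lemma through
  \<open>exists_prime_submodule_avoiding\<close>), and \<open>b\<^sup>k g \<notin> Q\<close>. For more primes, \<open>a\<^sub>i\<close> is
  the product over \<open>j \<noteq> i\<close> of such separating elements (\<open>orthogonal_elements\<close>).

  Nothing here bounds the number of minimal primes: applied to all finite sets of minimal primes,
  the construction gives arbitrarily large cliques when there are infinitely many. A single
  minimal prime needs only the existence of a vertex, and three of them produce a triangle.\<close>

section \<open>Submodules of a cyclic module\<close>

context Module.module
begin

lemma submodule_principal:
  assumes x: "x \<in> carrier M"
  shows "submodule {r \<odot>\<^bsub>M\<^esub> x | r. r \<in> carrier R} R M" (is "submodule ?X R M")
proof (rule submoduleI)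
  show "?X \<subseteq> carrier M" using x by auto
  show "\<zero>\<^bsub>M\<^esub> \<in> ?X" using x by (auto intro!: exI[of _ "\<zero>"])
  fix u assume "u \<in> ?X"
  then obtain r where r: "r \<in> carrier R" "u = r \<odot>\<^bsub>M\<^esub> x" by blast
  have "\<ominus>\<^bsub>M\<^esub> u = (\<ominus> r) \<odot>\<^bsub>M\<^esub> x" using r x by (simp add: smult_l_minus)
  then show "\<ominus>\<^bsub>M\<^esub> u \<in> ?X" using r by blast
  show "s \<odot>\<^bsub>M\<^esub> u \<in> ?X" if s: "s \<in> carrier R" for s
  proof -
    have "s \<odot>\<^bsub>M\<^esub> u = (s \<otimes> r) \<odot>\<^bsub>M\<^esub> x" using r s x by (simp add: smult_assoc1)
    then show ?thesis using r s by blast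
  qed
  show "u \<oplus>\<^bsub>M\<^esub> v \<in> ?X" if v: "v \<in> ?X" for v
  proof -
    obtain s where s: "s \<in> carrier R" "v = s \<odot>\<^bsub>M\<^esub> x" using v by blast
    have "u \<oplus>\<^bsub>M\<^esub> v = (r \<oplus> s) \<odot>\<^bsub>M\<^esub> x" using r s x by (simp add: smult_l_distr)
    then show ?thesis using r s by blast
  qed
qed

lemma zero_in_submodule: "submodule N R M \<Longrightarrow> \<zero>\<^bsub>M\<^esub> \<in> N"
  using subgroup.one_closed[OF submodule.axioms(1)] by fastforce

lemma submodule_adjoin:
  assumes N: "submodule N R M" and x: "x \<in> carrier M"
  shows "submodule {n \<oplus>\<^bsub>M\<^esub> r \<odot>\<^bsub>M\<^esub> x | n r. n \<in> N \<and> r \<in> carrier R} R M"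
    (is "submodule ?X R M")
proof (rule submoduleI)
  note NE = submoduleE[OF N]
  have Nc: "n \<in> carrier M" if "n \<in> N" for n using NE(1) that by blast
  show "?X \<subseteq> carrier M" using x Nc by auto
  have "\<zero>\<^bsub>M\<^esub> = \<zero>\<^bsub>M\<^esub> \<oplus>\<^bsub>M\<^esub> \<zero> \<odot>\<^bsub>M\<^esub> x" using x by simp
  then show "\<zero>\<^bsub>M\<^esub> \<in> ?X" using zero_in_submodule[OF N] by blast
  fix u assume "u \<in> ?X"
  then obtain n r where r: "n \<in> N" "r \<in> carrier R" "u = n \<oplus>\<^bsub>M\<^esub> r \<odot>\<^bsub>M\<^esub> x" by blast
  have "\<ominus>\<^bsub>M\<^esub> u = \<ominus>\<^bsub>M\<^esub> n \<oplus>\<^bsub>M\<^esub> (\<ominus> r) \<odot>\<^bsub>M\<^esub> x"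
    using r x Nc by (simp add: smult_l_minus M.minus_add)
  then show "\<ominus>\<^bsub>M\<^esub> u \<in> ?X" using r NE(3) by blast
  show "s \<odot>\<^bsub>M\<^esub> u \<in> ?X" if s: "s \<in> carrier R" for s
  proof -
    have "s \<odot>\<^bsub>M\<^esub> u = s \<odot>\<^bsub>M\<^esub> n \<oplus>\<^bsub>M\<^esub> (s \<otimes> r) \<odot>\<^bsub>M\<^esub> x"
      using r s x Nc by (simp add: smult_assoc1 smult_r_distr)
    then show ?thesis using r s NE(4) by blast
  qed
  show "u \<oplus>\<^bsub>M\<^esub> v \<in> ?X" if v: "v \<in> ?X" for v
  proof -
    obtain k s where s: "k \<in> N" "s \<in> carrier R" "v = k \<oplus>\<^bsub>M\<^esub> s \<odot>\<^bsub>M\<^esub> x" using v by blast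
    have "u \<oplus>\<^bsub>M\<^esub> v = (n \<oplus>\<^bsub>M\<^esub> k) \<oplus>\<^bsub>M\<^esub> (r \<oplus> s) \<odot>\<^bsub>M\<^esub> x"
      using r s x Nc by (simp add: smult_l_distr M.a_ac)
    then show ?thesis using r s NE(5) by blast
  qed
qed

lemma submodule_zero: "submodule {\<zero>\<^bsub>M\<^esub>} R M"
  by (rule submoduleI) auto

lemma submodule_Union_chain:
  assumes "C \<noteq> {}" and C: "subset.chain A C" and sub: "\<And>N. N \<in> C \<Longrightarrow> submodule N R M"
  shows "submodule (\<Union>C) R M"
proof (rule submoduleI)
  show "\<Union>C \<subseteq> carrier M" using submoduleE(1)[OF sub] by blast
  show "\<zero>\<^bsub>M\<^esub> \<in> \<Union>C" using assms(1) zero_in_submodule[OF sub] by blast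
  show "\<ominus>\<^bsub>M\<^esub> u \<in> \<Union>C" if "u \<in> \<Union>C" for u using that submoduleE(3)[OF sub] by blast
  show "s \<odot>\<^bsub>M\<^esub> u \<in> \<Union>C" if "s \<in> carrier R" "u \<in> \<Union>C" for s u
    using that submoduleE(4)[OF sub] by blast
  fix u v assume "u \<in> \<Union>C" "v \<in> \<Union>C"
  then obtain N K where NK: "N \<in> C" "K \<in> C" "u \<in> N" "v \<in> K" by blast
  then have "N \<subseteq> K \<or> K \<subseteq> N" using C by (auto simp: subset_chain_def)
  then have "u \<oplus>\<^bsub>M\<^esub> v \<in> N \<or> u \<oplus>\<^bsub>M\<^esub> v \<in> K"
    using submoduleE(5)[OF sub[OF NK(1)]] submoduleE(5)[OF sub[OF NK(2)]] NK(3,4) by blast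
  then show "u \<oplus>\<^bsub>M\<^esub> v \<in> \<Union>C" using NK by blast
qed

end

locale module_generator = Module.module R M
  for R :: "('a, 'r) ring_scheme" (structure) and M :: "('a, 'b, 'm) module_scheme" (structure) +
  fixes g :: 'b
  assumes gen_closed [simp]: "g \<in> carrier M"
    and carrier_gen: "carrier M = {r \<odot>\<^bsub>M\<^esub> g | r. r \<in> carrier R}"
begin

lemma gen_coeffE:
  assumes "x \<in> carrier M"
  obtains r where "r \<in> carrier R" "x = r \<odot>\<^bsub>M\<^esub> g"
  using assms carrier_gen by blast

text \<open>Multiplication by \<open>r\<close> commutes with taking multiples of the generator, so one test vector
  decides membership in the residual. This is what turns primality of a submodule
  into a statement about products of coefficients.\<close>

lemma colon_iff:
  assumes N: "submodule N R M" and r: "r \<in> carrier R"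
  shows "r \<in> colon R M N \<longleftrightarrow> r \<odot>\<^bsub>M\<^esub> g \<in> N"
proof
  assume "r \<odot>\<^bsub>M\<^esub> g \<in> N"
  have "r \<odot>\<^bsub>M\<^esub> x \<in> N" if x: "x \<in> carrier M" for x
  proof -
    obtain s where s: "s \<in> carrier R" "x = s \<odot>\<^bsub>M\<^esub> g" using gen_coeffE[OF x] .
    have "r \<odot>\<^bsub>M\<^esub> x = s \<odot>\<^bsub>M\<^esub> (r \<odot>\<^bsub>M\<^esub> g)"
      using r s by (simp add: smult_assoc1[symmetric] R.m_comm)
    then show ?thesis using submoduleE(4)[OF N s(1) \<open>r \<odot>\<^bsub>M\<^esub> g \<in> N\<close>] by simp
  qed
  then show "r \<in> colon R M N" using r by (simp add: colon_def)
qed (use r in \<open>simp add: colon_def\<close>)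

lemma prime_submodule_mult:
  assumes P: "prime_submodule R M P" and r: "r \<in> carrier R" and s: "s \<in> carrier R"
    and "r \<odot>\<^bsub>M\<^esub> g \<notin> P" "s \<odot>\<^bsub>M\<^esub> g \<notin> P"
  shows "(r \<otimes> s) \<odot>\<^bsub>M\<^esub> g \<notin> P"
proof
  assume "(r \<otimes> s) \<odot>\<^bsub>M\<^esub> g \<in> P"
  then have "r \<odot>\<^bsub>M\<^esub> (s \<odot>\<^bsub>M\<^esub> g) \<in> P" using r s by (simp add: smult_assoc1)
  then have "r \<in> colon R M P \<or> s \<odot>\<^bsub>M\<^esub> g \<in> P"
    using P r s unfolding prime_submodule_def by (meson gen_closed smult_closed)
  then show False using assms colon_iff[of P r] by (auto simp: prime_submodule_def)
qed

text \<open>In terms of coefficients of the generator this is \<open>1 \<notin> P\<close>: it starts the multiplicatively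
  closed sets below.\<close>

lemma gen_notin_prime_submodule:
  assumes P: "prime_submodule R M P"
  shows "g \<notin> P"
proof
  assume "g \<in> P"
  have sub: "submodule P R M" using P by (simp add: prime_submodule_def)
  have "carrier M \<subseteq> P" using submoduleE(4)[OF sub _ \<open>g \<in> P\<close>] carrier_gen by auto
  then show False using P submoduleE(1)[OF sub] by (auto simp: prime_submodule_def)
qed

section \<open>Minimal prime submodules\<close>

text \<open>Krull's argument: a submodule maximal among those that avoid the multiples of the
  generator by \<open>S\<close> is prime, since enlarging it by a multiple \<open>r g\<close> or \<open>u g\<close> forces it to meet
  \<open>S g\<close>, and multiplying the two resulting relations shows that \<open>r u g\<close> cannot lie in it.\<close>

lemma exists_prime_submodule_avoiding:
  assumes S: "S \<subseteq> carrier R" and one: "\<one> \<in> S"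
    and mult: "\<And>s t. s \<in> S \<Longrightarrow> t \<in> S \<Longrightarrow> s \<otimes> t \<in> S"
    and nz: "\<And>s. s \<in> S \<Longrightarrow> s \<odot>\<^bsub>M\<^esub> g \<noteq> \<zero>\<^bsub>M\<^esub>"
  shows "\<exists>Q. prime_submodule R M Q \<and> (\<forall>s \<in> S. s \<odot>\<^bsub>M\<^esub> g \<notin> Q)"
proof -
  define A where "A = {N. submodule N R M \<and> (\<forall>s \<in> S. s \<odot>\<^bsub>M\<^esub> g \<notin> N)}"
  have "\<exists>Q\<in>A. \<forall>X\<in>A. Q \<subseteq> X \<longrightarrow> X = Q"
  proof (rule subset_Zorn_nonempty)
    have "{\<zero>\<^bsub>M\<^esub>} \<in> A" using nz submodule_zero by (auto simp: A_def)
    then show "A \<noteq> {}" by blast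
    fix C assume C: "C \<noteq> {}" "subset.chain A C"
    then have "C \<subseteq> A" by (simp add: subset_chain_def)
    then show "\<Union>C \<in> A" using submodule_Union_chain[OF C] unfolding A_def by blast
  qed
  then obtain Q where "Q \<in> A" and max: "\<And>X. X \<in> A \<Longrightarrow> Q \<subseteq> X \<Longrightarrow> X = Q" by blast
  then have Q: "submodule Q R M" and avoid: "\<And>s. s \<in> S \<Longrightarrow> s \<odot>\<^bsub>M\<^esub> g \<notin> Q" by (auto simp: A_def)
  have Qc: "n \<in> carrier M" if "n \<in> Q" for n using submoduleE(1)[OF Q] that by blast
  have meet: "\<exists>s n x. s \<in> S \<and> n \<in> Q \<and> x \<in> carrier R \<and> s \<odot>\<^bsub>M\<^esub> g = n \<oplus>\<^bsub>M\<^esub> (x \<otimes> r) \<odot>\<^bsub>M\<^esub> g"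
    if r: "r \<in> carrier R" "r \<odot>\<^bsub>M\<^esub> g \<notin> Q" for r
  proof (rule ccontr)
    assume no: "\<not> ?thesis"
    let ?X = "{n \<oplus>\<^bsub>M\<^esub> x \<odot>\<^bsub>M\<^esub> (r \<odot>\<^bsub>M\<^esub> g) | n x. n \<in> Q \<and> x \<in> carrier R}"
    have "s \<odot>\<^bsub>M\<^esub> g \<notin> ?X" if "s \<in> S" for s
      using that no r by (auto simp: smult_assoc1)
    then have "?X \<in> A" using submodule_adjoin[OF Q, of "r \<odot>\<^bsub>M\<^esub> g"] r by (auto simp: A_def)
    moreover have "Q \<subseteq> ?X"
    proof
      fix n assume n: "n \<in> Q"
      have "n = n \<oplus>\<^bsub>M\<^esub> \<zero> \<odot>\<^bsub>M\<^esub> (r \<odot>\<^bsub>M\<^esub> g)" using Qc[OF n] r by simp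
      then show "n \<in> ?X" using n by blast
    qed
    ultimately have "?X = Q" by (rule max)
    moreover have "r \<odot>\<^bsub>M\<^esub> g = \<zero>\<^bsub>M\<^esub> \<oplus>\<^bsub>M\<^esub> \<one> \<odot>\<^bsub>M\<^esub> (r \<odot>\<^bsub>M\<^esub> g)" using r by simp
    then have "r \<odot>\<^bsub>M\<^esub> g \<in> ?X" using zero_in_submodule[OF Q] by blast
    ultimately show False using r by simp
  qed
  have "prime_submodule R M Q"
    unfolding prime_submodule_def
  proof (intro conjI ballI impI)
    show "Q \<noteq> carrier M" using avoid[OF one] by auto
    fix r e assume r: "r \<in> carrier R" and e: "e \<in> carrier M" and re: "r \<odot>\<^bsub>M\<^esub> e \<in> Q"
    obtain u where u: "u \<in> carrier R" "e = u \<odot>\<^bsub>M\<^esub> g" using gen_coeffE[OF e] .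
    show "r \<in> colon R M Q \<or> e \<in> Q"
    proof (rule ccontr)
      assume "\<not> ?thesis"
      then have "r \<odot>\<^bsub>M\<^esub> g \<notin> Q" "u \<odot>\<^bsub>M\<^esub> g \<notin> Q" using colon_iff[OF Q r] u by auto
      then obtain s n x t k y
        where s: "s \<in> S" "n \<in> Q" "x \<in> carrier R" "s \<odot>\<^bsub>M\<^esub> g = n \<oplus>\<^bsub>M\<^esub> (x \<otimes> r) \<odot>\<^bsub>M\<^esub> g"
          and t: "t \<in> S" "k \<in> Q" "y \<in> carrier R" "t \<odot>\<^bsub>M\<^esub> g = k \<oplus>\<^bsub>M\<^esub> (y \<otimes> u) \<odot>\<^bsub>M\<^esub> g"
        using meet[OF r] meet[OF u(1)] by blast
      have sR: "s \<in> carrier R" and tR: "t \<in> carrier R" using S s t by auto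
      have "(t \<otimes> s) \<odot>\<^bsub>M\<^esub> g = t \<odot>\<^bsub>M\<^esub> (s \<odot>\<^bsub>M\<^esub> g)" using sR tR by (simp add: smult_assoc1)
      also have "\<dots> = t \<odot>\<^bsub>M\<^esub> n \<oplus>\<^bsub>M\<^esub> t \<odot>\<^bsub>M\<^esub> ((x \<otimes> r) \<odot>\<^bsub>M\<^esub> g)"
        using tR s Qc r by (simp add: smult_r_distr)
      also have "t \<odot>\<^bsub>M\<^esub> ((x \<otimes> r) \<odot>\<^bsub>M\<^esub> g) = (x \<otimes> r) \<odot>\<^bsub>M\<^esub> (t \<odot>\<^bsub>M\<^esub> g)"
        using tR s r by (simp add: smult_assoc1[symmetric] R.m_comm)
      also have "\<dots> = (x \<otimes> r) \<odot>\<^bsub>M\<^esub> k \<oplus>\<^bsub>M\<^esub> (x \<otimes> r) \<odot>\<^bsub>M\<^esub> ((y \<otimes> u) \<odot>\<^bsub>M\<^esub> g)"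
        using s t r u Qc by (simp add: smult_r_distr)
      also have "(x \<otimes> r) \<odot>\<^bsub>M\<^esub> ((y \<otimes> u) \<odot>\<^bsub>M\<^esub> g) = (x \<otimes> y) \<odot>\<^bsub>M\<^esub> (r \<odot>\<^bsub>M\<^esub> e)"
        using s t r u by (simp add: smult_assoc1[symmetric] R.m_ac)
      finally have "(t \<otimes> s) \<odot>\<^bsub>M\<^esub> g =
        t \<odot>\<^bsub>M\<^esub> n \<oplus>\<^bsub>M\<^esub> ((x \<otimes> r) \<odot>\<^bsub>M\<^esub> k \<oplus>\<^bsub>M\<^esub> (x \<otimes> y) \<odot>\<^bsub>M\<^esub> (r \<odot>\<^bsub>M\<^esub> e))" .
      also have "\<dots> \<in> Q"
        using s t r re tR submoduleE(4,5)[OF Q] by simp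
      finally show False using avoid mult s t by blast
    qed
  qed (rule Q)
  then show ?thesis using avoid by blast
qed

text \<open>Otherwise the products of powers of \<open>b\<close> with coefficients outside \<open>P\<close> form a
  multiplicatively closed set none of whose members kills \<open>g\<close>, and some prime submodule avoids it.
  That submodule lies in \<open>P\<close> and misses \<open>b g\<close>, so it is strictly smaller than \<open>P\<close>. For ideals
  this is the fact that a minimal prime becomes nil in the localization at itself.\<close>

lemma minimal_prime_annihilator:
  assumes P: "P \<in> Min_prime R M" and b: "b \<in> carrier R" "b \<odot>\<^bsub>M\<^esub> g \<in> P"
  shows "\<exists>(k::nat) s. s \<in> carrier R \<and> s \<odot>\<^bsub>M\<^esub> g \<notin> P \<and> (b [^] k \<otimes> s) \<odot>\<^bsub>M\<^esub> g = \<zero>\<^bsub>M\<^esub>"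
proof (rule ccontr)
  assume no: "\<not> ?thesis"
  define S where "S = {b [^] k \<otimes> s | (k::nat) s. s \<in> carrier R \<and> s \<odot>\<^bsub>M\<^esub> g \<notin> P}"
  have pr: "prime_submodule R M P" using P by (simp add: Min_prime_def)
  have one: "\<one> \<odot>\<^bsub>M\<^esub> g \<notin> P" using gen_notin_prime_submodule[OF pr] by simp
  have mem: "b [^] k \<otimes> s \<in> S" if "s \<in> carrier R" "s \<odot>\<^bsub>M\<^esub> g \<notin> P" for k :: nat and s
    using that by (auto simp: S_def)
  have "\<exists>Q. prime_submodule R M Q \<and> (\<forall>s \<in> S. s \<odot>\<^bsub>M\<^esub> g \<notin> Q)"
  proof (rule exists_prime_submodule_avoiding)
    show "S \<subseteq> carrier R" using b by (auto simp: S_def)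
    show "\<one> \<in> S" using mem[OF R.one_closed one, of 0] by simp
    show "s \<odot>\<^bsub>M\<^esub> g \<noteq> \<zero>\<^bsub>M\<^esub>" if "s \<in> S" for s using that no by (auto simp: S_def)
    fix s t assume "s \<in> S" "t \<in> S"
    then obtain i j :: nat and u v where
      u: "u \<in> carrier R" "u \<odot>\<^bsub>M\<^esub> g \<notin> P" "s = b [^] i \<otimes> u" and
      v: "v \<in> carrier R" "v \<odot>\<^bsub>M\<^esub> g \<notin> P" "t = b [^] j \<otimes> v"
      by (auto simp: S_def)
    have "s \<otimes> t = b [^] (i + j) \<otimes> (u \<otimes> v)"
      using u v b by (simp add: R.nat_pow_mult[symmetric] R.m_ac)
    then show "s \<otimes> t \<in> S"
      using mem[of "u \<otimes> v" "i + j"] prime_submodule_mult[OF pr u(1) v(1) u(2) v(2)] u v by simp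
  qed
  then obtain Q where Q: "prime_submodule R M Q" and avoid: "\<And>s. s \<in> S \<Longrightarrow> s \<odot>\<^bsub>M\<^esub> g \<notin> Q"
    by blast
  have "Q \<subseteq> P"
  proof
    fix e assume e: "e \<in> Q"
    then have "e \<in> carrier M" using Q submoduleE(1) by (auto simp: prime_submodule_def)
    then obtain s where s: "s \<in> carrier R" "e = s \<odot>\<^bsub>M\<^esub> g" by (rule gen_coeffE)
    show "e \<in> P"
    proof (rule ccontr)
      assume "e \<notin> P"
      then have "s \<in> S" using mem[of s 0] s by simp
      then show False using avoid s e by blast
    qed
  qed
  then have "Q = P" using P Q by (auto simp: Min_prime_def)
  moreover have "b \<in> S" using mem[OF R.one_closed one, of 1] b by simp
  ultimately show False using avoid b by blast
qed

text \<open>Distinct minimal primes are incomparable, so some \<open>b g\<close> lies in \<open>P\<close> but not in \<open>Q\<close>. The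
  elements sought are the \<open>s\<close> that kills a power of \<open>b\<close> outside \<open>P\<close>, and that power of \<open>b\<close>, which
  stays outside \<open>Q\<close> because \<open>Q\<close> is prime.\<close>

lemma minimal_primes_separated:
  assumes P: "P \<in> Min_prime R M" and Q: "Q \<in> Min_prime R M" and "P \<noteq> Q"
  shows "\<exists>x \<in> carrier R. \<exists>y \<in> carrier R.
    x \<odot>\<^bsub>M\<^esub> g \<notin> P \<and> y \<odot>\<^bsub>M\<^esub> g \<notin> Q \<and> (x \<otimes> y) \<odot>\<^bsub>M\<^esub> g = \<zero>\<^bsub>M\<^esub>"
proof -
  have prP: "prime_submodule R M P" and prQ: "prime_submodule R M Q"
    using P Q by (auto simp: Min_prime_def)
  have "\<not> P \<subseteq> Q" using Q prP \<open>P \<noteq> Q\<close> by (auto simp: Min_prime_def)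
  then obtain e where e: "e \<in> P" "e \<notin> Q" by blast
  then have "e \<in> carrier M" using prP submoduleE(1) by (auto simp: prime_submodule_def)
  then obtain b where b: "b \<in> carrier R" "e = b \<odot>\<^bsub>M\<^esub> g" by (rule gen_coeffE)
  obtain k :: nat and s where s: "s \<in> carrier R" "s \<odot>\<^bsub>M\<^esub> g \<notin> P" "(b [^] k \<otimes> s) \<odot>\<^bsub>M\<^esub> g = \<zero>\<^bsub>M\<^esub>"
    using minimal_prime_annihilator[OF P b(1)] e b by blast
  have "b [^] i \<odot>\<^bsub>M\<^esub> g \<notin> Q" for i :: nat
  proof (induction i)
    case 0
    then show ?case using gen_notin_prime_submodule[OF prQ] by simp
  next
    case (Suc i)
    then show ?case using prime_submodule_mult[OF prQ _ b(1), of "b [^] i"] b e by simp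
  qed
  then show ?thesis
    using s b by (intro bexI[of _ s] bexI[of _ "b [^] k"]) (auto simp: R.m_comm)
qed

lemma prime_submodule_finprod:
  assumes P: "prime_submodule R M P" and "finite J"
    and "\<And>j. j \<in> J \<Longrightarrow> c j \<in> carrier R" "\<And>j. j \<in> J \<Longrightarrow> c j \<odot>\<^bsub>M\<^esub> g \<notin> P"
  shows "finprod R c J \<odot>\<^bsub>M\<^esub> g \<notin> P"
  using assms(2-)
proof (induction J)
  case empty
  then show ?case using gen_notin_prime_submodule[OF P] by simp
next
  case (insert j J)
  then have "finprod R c (insert j J) = c j \<otimes> finprod R c J"
    by (intro R.finprod_insert) auto
  moreover have "finprod R c J \<in> carrier R" using insert by (intro R.finprod_closed) auto
  ultimately show ?case using insert prime_submodule_mult[OF P] by simp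
qed

text \<open>Multiplying the separating elements of all pairs gives pairwise orthogonal elements: the
  product attached to \<open>P\<close> contains the factor that separates \<open>P\<close> from \<open>Q\<close>, the product attached
  to \<open>Q\<close> contains the opposite factor, and together these two already kill the generator.\<close>

lemma orthogonal_elements:
  assumes F: "finite F" "F \<subseteq> Min_prime R M"
  shows "\<exists>a. \<forall>P \<in> F. a P \<in> carrier R \<and> a P \<odot>\<^bsub>M\<^esub> g \<notin> P \<and>
    (\<forall>Q \<in> F. P \<noteq> Q \<longrightarrow> (a P \<otimes> a Q) \<odot>\<^bsub>M\<^esub> g = \<zero>\<^bsub>M\<^esub>)"
proof -
  have "\<forall>P Q. \<exists>x y. P \<in> F \<longrightarrow> Q \<in> F \<longrightarrow> P \<noteq> Q \<longrightarrow> x \<in> carrier R \<and> y \<in> carrier R \<and>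
    x \<odot>\<^bsub>M\<^esub> g \<notin> P \<and> y \<odot>\<^bsub>M\<^esub> g \<notin> Q \<and> (x \<otimes> y) \<odot>\<^bsub>M\<^esub> g = \<zero>\<^bsub>M\<^esub>"
    using minimal_primes_separated F(2) by blast
  then obtain x y where xy: "\<And>P Q. P \<in> F \<Longrightarrow> Q \<in> F \<Longrightarrow> P \<noteq> Q \<Longrightarrow>
    x P Q \<in> carrier R \<and> y P Q \<in> carrier R \<and> x P Q \<odot>\<^bsub>M\<^esub> g \<notin> P \<and> y P Q \<odot>\<^bsub>M\<^esub> g \<notin> Q \<and>
    (x P Q \<otimes> y P Q) \<odot>\<^bsub>M\<^esub> g = \<zero>\<^bsub>M\<^esub>"
    by metis
  \<comment> \<open>Separating elements are chosen for ordered pairs; using both orders makes \<open>c P Q\<close> a multiple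
    of \<open>x P Q\<close> and \<open>c Q P\<close> a multiple of the matching \<open>y P Q\<close>, for either order of \<open>P\<close> and \<open>Q\<close>.\<close>
  define c where "c P Q = x P Q \<otimes> y Q P" for P Q
  define a where "a P = finprod R (c P) (F - {P})" for P
  have pr: "prime_submodule R M P" if "P \<in> F" for P using F(2) that by (auto simp: Min_prime_def)
  have cR: "c P Q \<in> carrier R" if "P \<in> F" "Q \<in> F" "P \<noteq> Q" for P Q
    using xy[of P Q] xy[of Q P] that by (simp add: c_def)
  have cP: "c P Q \<odot>\<^bsub>M\<^esub> g \<notin> P" if "P \<in> F" "Q \<in> F" "P \<noteq> Q" for P Q
    using xy[of P Q] xy[of Q P] that prime_submodule_mult[OF pr] by (simp add: c_def)
  have aR: "a P \<in> carrier R" if "P \<in> F" for P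
    using cR that by (auto simp: a_def intro!: R.finprod_closed)
  have aP: "a P \<odot>\<^bsub>M\<^esub> g \<notin> P" if "P \<in> F" for P
    unfolding a_def using that F(1) cR cP by (intro prime_submodule_finprod[OF pr]) auto
  have factor: "\<exists>d \<in> carrier R. a P = c P Q \<otimes> d" if PQ: "P \<in> F" "Q \<in> F" "P \<noteq> Q" for P Q
  proof
    have eq: "F - {P} = insert Q (F - {P} - {Q})" using PQ by auto
    show "a P = c P Q \<otimes> finprod R (c P) (F - {P} - {Q})"
      unfolding a_def using cR PQ F(1) by (subst eq, subst R.finprod_insert) auto
    show "finprod R (c P) (F - {P} - {Q}) \<in> carrier R"
      using cR PQ by (intro R.finprod_closed) auto
  qed
  have "(a P \<otimes> a Q) \<odot>\<^bsub>M\<^esub> g = \<zero>\<^bsub>M\<^esub>" if PQ: "P \<in> F" "Q \<in> F" "P \<noteq> Q" for P Q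
  proof -
    obtain d e where d: "d \<in> carrier R" "a P = c P Q \<otimes> d" and e: "e \<in> carrier R" "a Q = c Q P \<otimes> e"
      using factor[OF PQ] factor[of Q P] PQ by blast
    have "a P \<otimes> a Q = (d \<otimes> e \<otimes> x Q P \<otimes> y Q P) \<otimes> (x P Q \<otimes> y P Q)"
      using d e xy[of P Q] xy[of Q P] PQ by (simp add: c_def R.m_ac)
    then have "(a P \<otimes> a Q) \<odot>\<^bsub>M\<^esub> g = (d \<otimes> e \<otimes> x Q P \<otimes> y Q P) \<odot>\<^bsub>M\<^esub> ((x P Q \<otimes> y P Q) \<odot>\<^bsub>M\<^esub> g)"
      using d e xy[of P Q] xy[of Q P] PQ by (simp add: smult_assoc1)
    then show ?thesis using d e xy[of P Q] xy[of Q P] PQ by simp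
  qed
  then show ?thesis using aR aP by (intro exI[of _ a]) blast
qed

section \<open>Cliques from minimal primes\<close>

text \<open>If \<open>i g = r a g\<close> and \<open>j g = s b g\<close>, then \<open>i j g = r s a b g = 0\<close>. Killing the
  generator passes to sums of such products and from \<open>g\<close> to every element of \<open>M\<close>.\<close>

lemma submodule_prod_principal_zero:
  assumes a: "a \<in> carrier R" and b: "b \<in> carrier R" and ab: "(a \<otimes> b) \<odot>\<^bsub>M\<^esub> g = \<zero>\<^bsub>M\<^esub>"
  shows "submodule_prod R M {r \<odot>\<^bsub>M\<^esub> (a \<odot>\<^bsub>M\<^esub> g) | r. r \<in> carrier R}
    {r \<odot>\<^bsub>M\<^esub> (b \<odot>\<^bsub>M\<^esub> g) | r. r \<in> carrier R} = {\<zero>\<^bsub>M\<^esub>}"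
    (is "submodule_prod R M ?A ?B = _")
proof -
  have kill: "w \<in> carrier R \<and> w \<odot>\<^bsub>M\<^esub> g = \<zero>\<^bsub>M\<^esub>"
    if "w \<in> ideal_prod R (colon R M ?A) (colon R M ?B)" for w
    using that
  proof induction
    case (prod i j)
    then have iR: "i \<in> carrier R" and jR: "j \<in> carrier R" by (auto simp: colon_def)
    obtain r where r: "r \<in> carrier R" "i \<odot>\<^bsub>M\<^esub> g = r \<odot>\<^bsub>M\<^esub> (a \<odot>\<^bsub>M\<^esub> g)"
      using prod by (auto simp: colon_def dest!: bspec[OF _ gen_closed])
    obtain s where s: "s \<in> carrier R" "j \<odot>\<^bsub>M\<^esub> g = s \<odot>\<^bsub>M\<^esub> (b \<odot>\<^bsub>M\<^esub> g)"
      using prod by (auto simp: colon_def dest!: bspec[OF _ gen_closed])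
    have "(i \<otimes> j) \<odot>\<^bsub>M\<^esub> g = i \<odot>\<^bsub>M\<^esub> (s \<odot>\<^bsub>M\<^esub> (b \<odot>\<^bsub>M\<^esub> g))"
      using iR jR s by (simp add: smult_assoc1)
    also have "\<dots> = (s \<otimes> b) \<odot>\<^bsub>M\<^esub> (i \<odot>\<^bsub>M\<^esub> g)"
      using iR s b by (simp add: smult_assoc1[symmetric] R.m_ac)
    also have "\<dots> = (s \<otimes> r) \<odot>\<^bsub>M\<^esub> ((a \<otimes> b) \<odot>\<^bsub>M\<^esub> g)"
      unfolding r(2) using r(1) s(1) a b by (simp add: smult_assoc1[symmetric] R.m_ac)
    finally show ?case using iR jR r s ab by simp
  next
    case (sum s1 s2)
    then show ?case by (simp add: smult_l_distr)
  qed
  have "w \<odot>\<^bsub>M\<^esub> x = \<zero>\<^bsub>M\<^esub>"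
    if w: "w \<in> ideal_prod R (colon R M ?A) (colon R M ?B)" and x: "x \<in> carrier M" for w x
  proof -
    obtain u where u: "u \<in> carrier R" "x = u \<odot>\<^bsub>M\<^esub> g" using gen_coeffE[OF x] .
    have "w \<odot>\<^bsub>M\<^esub> x = u \<odot>\<^bsub>M\<^esub> (w \<odot>\<^bsub>M\<^esub> g)"
      unfolding u(2) using conjunct1[OF kill[OF w]] u(1)
      by (simp add: smult_assoc1[symmetric] R.m_comm)
    then show ?thesis using kill[OF w] u by simp
  qed
  then have "{w \<odot>\<^bsub>M\<^esub> x | w x. w \<in> ideal_prod R (colon R M ?A) (colon R M ?B) \<and> x \<in> carrier M}
      \<subseteq> {\<zero>\<^bsub>M\<^esub>}"
    by blast
  then have "submodule_prod R M ?A ?B \<subseteq> {\<zero>\<^bsub>M\<^esub>}"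
    unfolding submodule_prod_def ideal_smult_def by (rule hull_minimal) (rule submodule_zero)
  moreover have "\<zero>\<^bsub>M\<^esub> \<in> submodule_prod R M ?A ?B"
    unfolding submodule_prod_def ideal_smult_def hull_def using zero_in_submodule by blast
  ultimately show ?thesis by blast
qed

text \<open>The vertices are the principal submodules generated by \<open>a\<^sub>P g\<close>, for an orthogonal family of
  coefficients \<open>a\<^sub>P\<close>. At least two primes are required, since the annihilating partner of a
  vertex, as well as the reason why the vertex is a proper submodule, comes from a second
  member of the family.\<close>

lemma exists_clique_of_minimal_primes:
  assumes F: "finite F" "F \<subseteq> Min_prime R M" "card F \<ge> 2"
  shows "\<exists>C. clique (AG R M) C \<and> finite C \<and> card C = card F"
proof -
  obtain a where aR: "\<And>P. P \<in> F \<Longrightarrow> a P \<in> carrier R"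
    and aP: "\<And>P. P \<in> F \<Longrightarrow> a P \<odot>\<^bsub>M\<^esub> g \<notin> P"
    and orth: "\<And>P Q. P \<in> F \<Longrightarrow> Q \<in> F \<Longrightarrow> P \<noteq> Q \<Longrightarrow> (a P \<otimes> a Q) \<odot>\<^bsub>M\<^esub> g = \<zero>\<^bsub>M\<^esub>"
    using orthogonal_elements[OF F(1,2)] by metis
  define N where "N P = {r \<odot>\<^bsub>M\<^esub> (a P \<odot>\<^bsub>M\<^esub> g) | r. r \<in> carrier R}" for P
  have pr: "prime_submodule R M P" if "P \<in> F" for P using F(2) that by (auto simp: Min_prime_def)
  have sub: "submodule (N P) R M" if "P \<in> F" for P
    unfolding N_def using aR[OF that] by (intro submodule_principal) simp
  have mem: "a P \<odot>\<^bsub>M\<^esub> g \<in> N P" if "P \<in> F" for P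
    unfolding N_def using aR[OF that] by (auto intro!: exI[of _ \<one>])
  have zeroP: "\<zero>\<^bsub>M\<^esub> \<in> P" if "P \<in> F" for P
    using pr[OF that] zero_in_submodule by (auto simp: prime_submodule_def)
  have nz: "N P \<noteq> {\<zero>\<^bsub>M\<^esub>}" if "P \<in> F" for P
    using mem[OF that] aP[OF that] zeroP[OF that] by auto
  have prod0: "submodule_prod R M (N P) (N Q) = {\<zero>\<^bsub>M\<^esub>}" if "P \<in> F" "Q \<in> F" "P \<noteq> Q" for P Q
    unfolding N_def using submodule_prod_principal_zero aR orth that by blast
  have notin: "a P \<odot>\<^bsub>M\<^esub> g \<notin> N Q" if PQ: "P \<in> F" "Q \<in> F" "P \<noteq> Q" for P Q
  proof
    assume "a P \<odot>\<^bsub>M\<^esub> g \<in> N Q"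
    then obtain r where r: "r \<in> carrier R" "a P \<odot>\<^bsub>M\<^esub> g = r \<odot>\<^bsub>M\<^esub> (a Q \<odot>\<^bsub>M\<^esub> g)"
      by (auto simp: N_def)
    have "(a P \<otimes> a P) \<odot>\<^bsub>M\<^esub> g = a P \<odot>\<^bsub>M\<^esub> (r \<odot>\<^bsub>M\<^esub> (a Q \<odot>\<^bsub>M\<^esub> g))"
      using aR PQ r by (simp add: smult_assoc1)
    also have "\<dots> = r \<odot>\<^bsub>M\<^esub> ((a P \<otimes> a Q) \<odot>\<^bsub>M\<^esub> g)"
      using aR PQ r(1) by (simp add: smult_assoc1[symmetric] R.m_ac)
    also have "\<dots> = \<zero>\<^bsub>M\<^esub>" using orth[OF PQ] r by simp
    finally show False
      using prime_submodule_mult[OF pr[OF PQ(1)] aR aR aP aP] PQ zeroP by auto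
  qed
  have inj: "inj_on N F"
    using mem notin by (auto intro!: inj_onI)
  have other: "\<exists>Q \<in> F. P \<noteq> Q" for P
  proof (rule ccontr)
    assume "\<not> ?thesis"
    then have "F \<subseteq> {P}" by auto
    then have "card F \<le> card {P}" by (intro card_mono) auto
    then show False using F(3) by simp
  qed
  have proper: "N P \<noteq> carrier M" if P: "P \<in> F" for P
  proof -
    obtain Q where "Q \<in> F" "P \<noteq> Q" using other by blast
    then have "a Q \<odot>\<^bsub>M\<^esub> g \<notin> N P" "a Q \<odot>\<^bsub>M\<^esub> g \<in> carrier M" using notin P aR by auto
    then show ?thesis by blast
  qed
  have vert: "N P \<in> AG_verts R M" if P: "P \<in> F" for P
  proof -
    obtain Q where Q: "Q \<in> F" "P \<noteq> Q" using other by blast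
    then have "submodule (N Q) R M \<and> N Q \<noteq> {\<zero>\<^bsub>M\<^esub>} \<and> N Q \<noteq> carrier M \<and>
        submodule_prod R M (N P) (N Q) = {\<zero>\<^bsub>M\<^esub>}"
      by (intro conjI sub nz proper prod0 P)
    then show ?thesis unfolding AG_verts_def using sub[OF P] nz[OF P] by auto
  qed
  have "clique (AG R M) (N ` F)"
    unfolding clique_def
  proof (intro conjI pairwiseI)
    show "N ` F \<subseteq> uverts (AG R M)" using vert by (auto simp: AG_def)
    fix U V assume "U \<in> N ` F" "V \<in> N ` F" and UV: "U \<noteq> V"
    then obtain P Q where PQ: "P \<in> F" "Q \<in> F" "U = N P" "V = N Q" by blast
    then have "P \<noteq> Q" using UV by blast
    then have "submodule_prod R M U V = {\<zero>\<^bsub>M\<^esub>}" using prod0 PQ by simp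
    moreover have "U \<in> AG_verts R M" "V \<in> AG_verts R M" using vert PQ by auto
    ultimately show "{U, V} \<in> uedges (AG R M)" unfolding AG_def snd_conv using UV by blast
  qed
  then show ?thesis using F(1) card_image[OF inj] by blast
qed

end

section \<open>Clique number and girth\<close>

lemma clique_number_ge:
  assumes "clique G C" "finite C"
  shows "enat (card C) \<le> clique_number G"
  unfolding clique_number_def by (rule SUP_upper2[of C]) (use assms in \<open>auto simp: ecard_def\<close>)

lemma exists_finite_subset_ecard:
  assumes "enat n \<le> ecard A"
  shows "\<exists>F. finite F \<and> F \<subseteq> A \<and> card F = n"
proof (cases "finite A")
  case True
  then have "n \<le> card A" using assms by (simp add: ecard_def)
  then show ?thesis using obtain_subset_with_card_n[of n A] by metis
next
  case False
  then show ?thesis using infinite_arbitrarily_large by blast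
qed

lemma ecard_leI:
  assumes "\<And>F. finite F \<Longrightarrow> F \<subseteq> A \<Longrightarrow> enat (card F) \<le> k"
  shows "ecard A \<le> k"
proof (cases "finite A")
  case True
  then show ?thesis using assms by (simp add: ecard_def)
next
  case False
  have le: "enat n \<le> k" for n
    using infinite_arbitrarily_large[OF False, of n] assms by blast
  have "k = \<infinity>"
  proof (cases k)
    case (enat m)
    then show ?thesis using le[of "Suc m"] by simp
  qed
  then show ?thesis by simp
qed

lemma girth_eq_3I:
  assumes C: "clique G C" "card C = 3"
  shows "girth G = 3"
proof (rule antisym)
  obtain u v w where uvw: "C = {u, v, w}" "u \<noteq> v" "u \<noteq> w" "v \<noteq> w"
    using C(2) by (auto simp: card_3_iff)
  have edge: "{x, y} \<in> uedges G" if "x \<in> C" "y \<in> C" "x \<noteq> y" for x y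
    using C(1) that by (auto simp: clique_def pairwise_def)
  have "\<forall>i < length [u, v, w]. {[u, v, w] ! i, [u, v, w] ! (Suc i mod length [u, v, w])} \<in> uedges G"
  proof (intro allI impI)
    fix i assume "i < length [u, v, w]"
    then have "i < 3" by simp
    then consider "i = 0" | "i = 1" | "i = 2" by linarith
    then show "{[u, v, w] ! i, [u, v, w] ! (Suc i mod length [u, v, w])} \<in> uedges G"
      using edge[of u v] edge[of v w] edge[of w u] uvw by cases simp_all
  qed
  moreover have "set [u, v, w] \<subseteq> uverts G" using C(1) uvw(1) by (simp add: clique_def)
  moreover have "distinct [u, v, w]" "length [u, v, w] \<ge> 3" using uvw by simp_all
  ultimately have "cycle G [u, v, w]" unfolding cycle_def by blast
  then have cyc: "[u, v, w] \<in> {vs. cycle G vs}" by simp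
  show "girth G \<le> 3"
    unfolding girth_def
    by (rule INF_lower2[OF cyc]) (simp add: numeral_eq_enat)
  show "3 \<le> girth G"
    unfolding girth_def by (rule INF_greatest) (simp add: cycle_def numeral_eq_enat)
qed

theorem corollary2p19:
  fixes R :: "('a, 'r) ring_scheme" and M :: "('a, 'b, 'm) module_scheme"
  assumes "cring R" and "\<one>\<^bsub>R\<^esub> \<noteq> \<zero>\<^bsub>R\<^esub>"
    and "Module.module R M" and "cyclic_module R M"
    and "uverts (AG R M) \<noteq> {}"
  shows "clique_number (AG R M) \<ge> ecard (Min_prime R M) \<and>
    (ecard (Min_prime R M) \<ge> 3 \<longrightarrow> girth (AG R M) = 3)"
proof -
  obtain g where g: "g \<in> carrier M" "carrier M = {r \<odot>\<^bsub>M\<^esub> g | r. r \<in> carrier R}"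
    using assms(4) by (auto simp: cyclic_module_def)
  interpret module_generator R M g
    using assms(3) g by (intro module_generator.intro module_generator_axioms.intro)
  obtain v where v: "v \<in> uverts (AG R M)" using assms(5) by blast
  have "clique (AG R M) {v}" using v by (simp add: clique_def)
  then have one: "enat 1 \<le> clique_number (AG R M)" using clique_number_ge[of _ "{v}"] by simp
  have "ecard (Min_prime R M) \<le> clique_number (AG R M)"
  proof (rule ecard_leI)
    fix F assume F: "finite F" "F \<subseteq> Min_prime R M"
    show "enat (card F) \<le> clique_number (AG R M)"
    proof (cases "card F \<ge> 2")
      case True
      then show ?thesis using exists_clique_of_minimal_primes[OF F True] clique_number_ge[of "AG R M"] by metis
    next
      case False
      then have "enat (card F) \<le> enat 1" by simp
      then show ?thesis using one by (rule order_trans)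
    qed
  qed
  moreover have "girth (AG R M) = 3" if "ecard (Min_prime R M) \<ge> 3"
  proof -
    have "enat 3 \<le> ecard (Min_prime R M)" using that by (simp only: numeral_eq_enat)
    then obtain F where F: "finite F" "F \<subseteq> Min_prime R M" "card F = 3"
      by (auto dest: exists_finite_subset_ecard)
    then obtain C where "clique (AG R M) C" "card C = 3"
      using exists_clique_of_minimal_primes[OF F(1,2)] by auto
    then show ?thesis by (rule girth_eq_3I)
  qed
  ultimately show ?thesis by blast
qed

end
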